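(* TRO equivalence is an equivalence relation on the class of $w^*$-closed algebras of operators on Hilbert spaces.
   Context: For Hilbert spaces $H_1,H_2$, $B(H_1,H_2)$ denotes the bounded linear operators from $H_1$ to $H_2$. For sets of operators, $\mathcal{X}^*=\{X^*:X\in\mathcal{X}\}$, $\mathcal{X}\mathcal{Y}=\{XY: X\in\mathcal{X},Y\in\mathcal{Y}\}$, and $\mathrm{span}(\mathcal{X})^{-w^*}$ is the weak-$*$ closure of the linear span. An algebra is a subalgebra (not necessarily selfadjoint or unital) of $B(H)$ for some Hilbert space $H$. A ternary ring of operators (TRO) is a linear subspace $\mathcal{M}\subset B(H_1,H_2)$ with $\mathcal{M}\mathcal{M}^*\mathcal{M}\subset\mathcal{M}$. Two $w^*$-closed algebras $\mathcal{A}\subset B(H_1)$, $\mathcal{B}\subset B(H_2)$ are TRO equivalent if there is a TRO $\mathcal{M}\subset B(H_1,H_2)$ with $\mathcal{A}=\mathrm{span}(\mathcal{M}^*\mathcal{B}\mathcal{M})^{-w^*}$ and $\mathcal{B}=\mathrm{span}(\mathcal{M}\mathcal{A}\mathcal{M}^* )^{-w^*}$. *)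

theory Defs
  imports "HOL-Analysis.Analysis"
begin

text \<open>The inner product is linear in the first and conjugate linear in the second argument.
  Positive definiteness is part of \<open>cinner_self\<close>, since the norm comes from the superclass.\<close>

class complex_hilbert = banach +
  fixes scaleC :: "complex \<Rightarrow> 'a \<Rightarrow> 'a" (infixr "*\<^sub>C" 75)
    and cinner :: "'a \<Rightarrow> 'a \<Rightarrow> complex"
  assumes scaleC_add_right: "a *\<^sub>C (x + y) = a *\<^sub>C x + a *\<^sub>C y"
    and scaleC_add_left: "(a + b) *\<^sub>C x = a *\<^sub>C x + b *\<^sub>C x"
    and scaleC_scaleC: "a *\<^sub>C (b *\<^sub>C x) = (a * b) *\<^sub>C x"
    and scaleC_of_real: "complex_of_real r *\<^sub>C x = r *\<^sub>R x"
    and cinner_commute: "cinner x y = cnj (cinner y x)"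
    and cinner_add_left: "cinner (x + y) z = cinner x z + cinner y z"
    and cinner_scaleC_left: "cinner (a *\<^sub>C x) y = a * cinner x y"
    and cinner_self: "cinner x x = complex_of_real ((norm x)\<^sup>2)"

instantiation complex :: complex_hilbert
begin
definition scaleC_complex :: "complex \<Rightarrow> complex \<Rightarrow> complex" where
  "scaleC_complex = (*)"
definition cinner_complex :: "complex \<Rightarrow> complex \<Rightarrow> complex" where
  "cinner_complex x y = x * cnj y"
instance
proof
  fix x :: complex
  show "cinner x x = complex_of_real ((norm x)\<^sup>2)"
    by (simp only: cinner_complex_def complex_norm_square)
qed (simp_all add: scaleC_complex_def cinner_complex_def algebra_simps scaleR_conv_of_real)
end

typedef (overloaded) ('a, 'b) cblinfun =
  "{f :: 'a::complex_hilbert \<Rightarrow> 'b::complex_hilbert.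
      bounded_linear f \<and> (\<forall>c x. f (c *\<^sub>C x) = c *\<^sub>C f x)}"
  morphisms app Cblinfun
proof -
  have "c *\<^sub>C (0 :: 'b) = 0" for c
    using scaleC_add_right[of c "0 :: 'b" 0] by simp
  then show ?thesis
    by (intro exI[of _ "\<lambda>_. 0"]) (auto simp: bounded_linear_zero)
qed

setup_lifting type_definition_cblinfun

lemma bounded_linear_scaleC: "bounded_linear (\<lambda>x :: 'a::complex_hilbert. c *\<^sub>C x)"
proof (rule bounded_linear_intro)
  fix x y :: 'a and r :: real
  show "c *\<^sub>C (x + y) = c *\<^sub>C x + c *\<^sub>C y"
    by (rule scaleC_add_right)
  show "c *\<^sub>C (r *\<^sub>R x) = r *\<^sub>R (c *\<^sub>C x)"
    by (simp only: scaleC_of_real[symmetric] scaleC_scaleC mult.commute)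
  have "cinner x (c *\<^sub>C x) = cnj c * cinner x x"
    by (subst cinner_commute) (simp add: cinner_scaleC_left cinner_self)
  then have "cinner (c *\<^sub>C x) (c *\<^sub>C x) = (c * cnj c) * cinner x x"
    by (simp add: cinner_scaleC_left)
  then have "complex_of_real ((norm (c *\<^sub>C x))\<^sup>2) = complex_of_real ((cmod c)\<^sup>2 * (norm x)\<^sup>2)"
    by (simp only: cinner_self of_real_mult complex_norm_square)
  then have "(norm (c *\<^sub>C x))\<^sup>2 = (norm x * cmod c)\<^sup>2"
    by (simp only: of_real_eq_iff power_mult_distrib mult.commute)
  then show "norm (c *\<^sub>C x) \<le> norm x * cmod c"
    by (rule power2_le_imp_le[OF eq_refl]) simp
qed

lemma scaleC_zero_right: "c *\<^sub>C (0 :: 'a::complex_hilbert) = 0"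
  using linear_simps(3)[OF bounded_linear_scaleC] .

lemma scaleC_minus_right: "c *\<^sub>C (- x) = - (c *\<^sub>C (x :: 'a::complex_hilbert))"
  using linear_simps(4)[OF bounded_linear_scaleC] .

lemma scaleC_diff_right: "c *\<^sub>C (x - y) = c *\<^sub>C x - c *\<^sub>C (y :: 'a::complex_hilbert)"
  using linear_simps(2)[OF bounded_linear_scaleC] .

instantiation cblinfun :: (complex_hilbert, complex_hilbert) ab_group_add
begin
lift_definition zero_cblinfun :: "('a, 'b) cblinfun" is "\<lambda>_. 0"
  by (simp add: bounded_linear_zero scaleC_zero_right)
lift_definition plus_cblinfun :: "('a, 'b) cblinfun \<Rightarrow> ('a, 'b) cblinfun \<Rightarrow> ('a, 'b) cblinfun"
  is "\<lambda>f g x. f x + g x"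
  by (simp add: bounded_linear_add scaleC_add_right)
lift_definition uminus_cblinfun :: "('a, 'b) cblinfun \<Rightarrow> ('a, 'b) cblinfun"
  is "\<lambda>f x. - f x"
  by (simp add: bounded_linear_minus scaleC_minus_right)
lift_definition minus_cblinfun :: "('a, 'b) cblinfun \<Rightarrow> ('a, 'b) cblinfun \<Rightarrow> ('a, 'b) cblinfun"
  is "\<lambda>f g x. f x - g x"
  by (simp add: bounded_linear_sub scaleC_diff_right)
instance
  by (standard; transfer; simp add: fun_eq_iff algebra_simps)
end

lift_definition scale_op ::
  "complex \<Rightarrow> ('a::complex_hilbert, 'b::complex_hilbert) cblinfun \<Rightarrow> ('a, 'b) cblinfun"
  is "\<lambda>c f x. c *\<^sub>C f x"
  by (simp add: bounded_linear_compose[OF bounded_linear_scaleC] scaleC_scaleC mult.commute)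

text \<open>This provides the complex-linear \<open>cop.subspace\<close> and \<open>cop.span\<close>.\<close>

global_interpretation cop: vector_space
  "scale_op :: complex \<Rightarrow> ('a::complex_hilbert, 'b::complex_hilbert) cblinfun \<Rightarrow> ('a, 'b) cblinfun"
proof (standard, goal_cases)
  case (4 x)
  show ?case
  proof (transfer, rule ext)
    fix f :: "'a \<Rightarrow> 'b" and x
    show "1 *\<^sub>C f x = f x"
      using scaleC_of_real[of 1 "f x"] by simp
  qed
qed (transfer; simp add: scaleC_add_right scaleC_add_left scaleC_scaleC)+

lift_definition comp_op ::
  "('b::complex_hilbert, 'c::complex_hilbert) cblinfun \<Rightarrow> ('a::complex_hilbert, 'b) cblinfun
    \<Rightarrow> ('a, 'c) cblinfun" (infixl "\<circ>\<^sub>C" 67)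
  is "\<lambda>f g x. f (g x)"
  by (simp add: bounded_linear_compose)

text \<open>The adjoint exists by the Riesz representation theorem and is unique, so \<open>THE\<close> is well defined.\<close>

definition adj ::
  "('a::complex_hilbert, 'b::complex_hilbert) cblinfun \<Rightarrow> ('b, 'a) cblinfun" where
  "adj T = (THE S. \<forall>x y. cinner (app T x) y = cinner x (app S y))"

definition op_prod ::
  "('b::complex_hilbert, 'c::complex_hilbert) cblinfun set \<Rightarrow> ('a::complex_hilbert, 'b) cblinfun set
    \<Rightarrow> ('a, 'c) cblinfun set" (infixl "\<cdot>\<^sub>C" 67)
  where "X \<cdot>\<^sub>C Y = {S \<circ>\<^sub>C T | S T. S \<in> X \<and> T \<in> Y}"

text \<open>The predual of the bounded operators is the space of trace class operators. These are the
  sums of rank-one operators given by two square-summable sequences \<open>x\<close>, \<open>y\<close> of vectors, and such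
  an operator pairs with \<open>T\<close> as \<open>\<Sum>n. \<langle>T (x n), y n\<rangle>\<close>.
  Hence the weak-* topology is the initial topology of these functionals.\<close>

definition square_summable :: "(nat \<Rightarrow> 'a::real_normed_vector) \<Rightarrow> bool" where
  "square_summable x \<longleftrightarrow> summable (\<lambda>n. (norm (x n))\<^sup>2)"

definition normal_functional ::
  "(nat \<Rightarrow> 'a) \<Rightarrow> (nat \<Rightarrow> 'b) \<Rightarrow> ('a::complex_hilbert, 'b::complex_hilbert) cblinfun \<Rightarrow> complex" where
  "normal_functional x y T = (\<Sum>n. cinner (app T (x n)) (y n))"

definition weak_star :: "('a::complex_hilbert, 'b::complex_hilbert) cblinfun topology" where
  "weak_star = topology_generated_by
     {normal_functional x y -` U | x y U. square_summable x \<and> square_summable y \<and> open U}"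

definition wspan ::
  "('a::complex_hilbert, 'b::complex_hilbert) cblinfun set \<Rightarrow> ('a, 'b) cblinfun set" where
  "wspan X = weak_star closure_of (cop.span X)"

definition wstar_closed_algebra :: "('a::complex_hilbert, 'a) cblinfun set \<Rightarrow> bool" where
  "wstar_closed_algebra \<A> \<longleftrightarrow>
     cop.subspace \<A> \<and> \<A> \<cdot>\<^sub>C \<A> \<subseteq> \<A> \<and> closedin weak_star \<A>"

definition tro :: "('a::complex_hilbert, 'b::complex_hilbert) cblinfun set \<Rightarrow> bool" where
  "tro \<M> \<longleftrightarrow> cop.subspace \<M> \<and> \<M> \<cdot>\<^sub>C adj ` \<M> \<cdot>\<^sub>C \<M> \<subseteq> \<M>"

definition tro_equivalent ::
  "('a::complex_hilbert, 'a) cblinfun set \<Rightarrow> ('b::complex_hilbert, 'b) cblinfun set \<Rightarrow> bool" where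
  "tro_equivalent \<A> \<B> \<longleftrightarrow>
     (\<exists>\<M> :: ('a, 'b) cblinfun set. tro \<M> \<and>
        \<A> = wspan (adj ` \<M> \<cdot>\<^sub>C \<B> \<cdot>\<^sub>C \<M>) \<and>
        \<B> = wspan (\<M> \<cdot>\<^sub>C \<A> \<cdot>\<^sub>C adj ` \<M>))"

end

theory Submission
  imports Defs
begin

text \<open>Reflexivity is witnessed by the scalar operators and symmetry by the adjoint of the TRO.
  For transitivity, let \<open>\<M>\<close> link \<open>\<A>\<close> to \<open>\<B>\<close> and \<open>\<N>\<close> link \<open>\<B>\<close> to \<open>\<C>\<close>. The operators \<open>T\<close> for which
  \<open>T\<close> and \<open>T\<^sup>*\<close> are two-sided multipliers of \<open>\<B>\<close> form a unital selfadjoint algebra \<open>\<D>\<close>. It contains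
  \<open>\<M>\<M>\<^sup>*\<close> and \<open>\<N>\<^sup>*\<N>\<close>, by the TRO identity and the separate weak-* continuity of the product. Hence the span
  of \<open>\<N>\<D>\<M>\<close> is a TRO; it contains \<open>\<N>\<M>\<close>, and since \<open>\<D>\<B>\<D> \<subseteq> \<B>\<close> it links \<open>\<A>\<close> to \<open>\<C>\<close>.\<close>

section \<open>The complex inner product\<close>

lemma cinner_add_right: "cinner x (y + z) = cinner x y + cinner x (z :: 'a::complex_hilbert)"
  by (metis cinner_add_left cinner_commute complex_cnj_add)

lemma cinner_scaleC_right: "cinner x (c *\<^sub>C y) = cnj c * cinner x (y :: 'a::complex_hilbert)"
  by (metis cinner_scaleC_left cinner_commute complex_cnj_mult)

lemma cinner_scaleR_left: "cinner (r *\<^sub>R x) y = of_real r * cinner x (y :: 'a::complex_hilbert)"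
  by (metis cinner_scaleC_left scaleC_of_real)

lemma cinner_scaleR_right: "cinner x (r *\<^sub>R y) = of_real r * cinner x (y :: 'a::complex_hilbert)"
  by (metis cinner_scaleC_right scaleC_of_real complex_cnj_complex_of_real)

lemma cinner_diff_left: "cinner (x - y) z = cinner x z - cinner y (z :: 'a::complex_hilbert)"
  using cinner_add_left[of "x - y" y z] by (simp add: algebra_simps)

lemma cinner_diff_right: "cinner x (y - z) = cinner x y - cinner x (z :: 'a::complex_hilbert)"
  using cinner_add_right[of x "y - z" z] by (simp add: algebra_simps)

lemma Re_cinner_commute: "Re (cinner x y) = Re (cinner y (x :: 'a::complex_hilbert))"
  by (subst cinner_commute) simp

lemma Re_cinner_self: "Re (cinner x x) = (norm (x :: 'a::complex_hilbert))\<^sup>2"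
  by (simp add: cinner_self)

lemma norm_add_power2:
  "(norm (x + y))\<^sup>2 = (norm x)\<^sup>2 + 2 * Re (cinner x y) + (norm (y :: 'a::complex_hilbert))\<^sup>2"
  using Re_cinner_commute[of x y]
  by (simp add: Re_cinner_self[symmetric] cinner_add_left cinner_add_right)

lemma norm_diff_power2:
  "(norm (x - y))\<^sup>2 = (norm x)\<^sup>2 - 2 * Re (cinner x y) + (norm (y :: 'a::complex_hilbert))\<^sup>2"
  using Re_cinner_commute[of x y]
  by (simp add: Re_cinner_self[symmetric] cinner_diff_left cinner_diff_right)

lemma norm_scaleC: "norm (c *\<^sub>C x) = cmod c * norm (x :: 'a::complex_hilbert)"
proof (rule power2_eq_imp_eq)
  have "complex_of_real ((norm (c *\<^sub>C x))\<^sup>2) = (c * cnj c) * cinner x x"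
    by (simp only: cinner_self[symmetric] cinner_scaleC_left cinner_scaleC_right ac_simps)
  also have "\<dots> = complex_of_real ((cmod c * norm x)\<^sup>2)"
    by (simp only: cinner_self complex_norm_square[symmetric] power_mult_distrib of_real_mult)
  finally show "(norm (c *\<^sub>C x))\<^sup>2 = (cmod c * norm x)\<^sup>2"
    by (simp only: of_real_eq_iff)
qed auto

text \<open>Cauchy-Schwarz inequality. The norm already satisfies the triangle inequality, and
  squaring that bounds the real part. Multiplying \<open>x\<close> by a unimodular scalar then makes
  the inner product real and nonnegative.\<close>

lemma norm_cinner_le: "cmod (cinner x y) \<le> norm x * norm (y :: 'a::complex_hilbert)"
proof -
  have real_part: "Re (cinner u y) \<le> norm u * norm y" for u
  proof -
    have "(norm (u + y))\<^sup>2 \<le> (norm u + norm y)\<^sup>2"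
      by (simp add: norm_triangle_ineq power_mono)
    then show ?thesis
      by (simp add: norm_add_power2 power2_sum)
  qed
  show ?thesis
  proof (cases "cinner x y = 0")
    case False
    define c where "c = cnj (sgn (cinner x y))"
    have "c * cinner x y = of_real (cmod (cinner x y))"
      using False complex_norm_square[of "cinner x y"]
      by (simp add: c_def sgn_eq field_simps power2_eq_square)
    then have "cmod (cinner x y) = Re (cinner (c *\<^sub>C x) y)"
      by (simp add: cinner_scaleC_left)
    also have "\<dots> \<le> norm (c *\<^sub>C x) * norm y"
      by (rule real_part)
    also have "norm (c *\<^sub>C x) = norm x"
      using False by (simp add: norm_scaleC c_def norm_sgn)
    finally show ?thesis .
  qed auto
qed

lemma bounded_linear_cinner_left: "bounded_linear (\<lambda>x. cinner x (y :: 'a::complex_hilbert))"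
  by (rule bounded_linear_intro[where K = "norm y"])
    (simp_all add: cinner_add_left cinner_scaleR_left norm_cinner_le scaleR_conv_of_real)

lemma cinner_eqI_right:
  assumes "\<And>z. cinner z x = cinner z y"
  shows "x = (y :: 'a::complex_hilbert)"
proof -
  have "cinner (x - y) (x - y) = 0"
    using assms by (simp add: cinner_diff_right)
  then show ?thesis
    by (simp add: cinner_self)
qed

text \<open>First-order condition at a minimum, used for the variational argument in the Riesz
  theorem: a small step against the sign of \<open>b\<close> would make the quadratic
  negative.\<close>

lemma linear_term_zero:
  fixes a b :: real
  assumes "\<And>t. 0 \<le> t\<^sup>2 * a + 2 * t * b"
  shows "b = 0"
proof (rule ccontr)
  assume "b \<noteq> 0"
  \<comment> \<open>Any positive \<open>s\<close> with \<open>a < 2 * s\<close> serves; this one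
    covers both signs of \<open>a\<close>.\<close>
  define s where "s = 1 + \<bar>a\<bar>"
  have s: "0 < s" "a < 2 * s"
    by (auto simp: s_def)
  have "(- b / s)\<^sup>2 * a + 2 * (- b / s) * b = (b\<^sup>2 / s\<^sup>2) * (a - 2 * s)"
    using s(1) by (simp add: power2_eq_square field_simps)
  moreover have "(b\<^sup>2 / s\<^sup>2) * (a - 2 * s) < 0"
    using s \<open>b \<noteq> 0\<close> by (intro mult_pos_neg) auto
  ultimately show False
    using assms[of "- b / s"] by argo
qed

text \<open>The representing vector minimises \<open>\<parallel>x\<parallel>\<^sup>2 - 2 Re (f x)\<close>; minimising sequences are Cauchy by the
  parallelogram law.\<close>

lemma riesz_representation:
  fixes f :: "'a::complex_hilbert \<Rightarrow> complex"
  assumes f: "bounded_linear f" and fC: "\<And>c x. f (c *\<^sub>C x) = c * f x"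
  shows "\<exists>z. \<forall>x. f x = cinner x z"
proof -
  interpret bounded_linear f by (rule f)
  define J where "J x = (norm x)\<^sup>2 - 2 * Re (f x)" for x
  define I where "I = Inf (range J)"
  obtain K where K: "\<And>x. cmod (f x) \<le> norm x * K"
    using bounded by blast
  \<comment> \<open>Completing the square: \<open>J x\<close> is at least
    \<open>(norm x - K)\<^sup>2 - K\<^sup>2\<close>.\<close>
  have "- K\<^sup>2 \<le> J x" for x
  proof -
    have "Re (f x) \<le> norm x * K"
      using K[of x] complex_Re_le_cmod[of "f x"] by argo
    moreover have "0 \<le> (norm x - K)\<^sup>2"
      by simp
    ultimately show ?thesis
      by (simp add: J_def power2_diff)
  qed
  then have bdd: "bdd_below (range J)"
    by (intro bdd_belowI[of _ "- K\<^sup>2"]) auto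
  then have I: "I \<le> J x" for x
    unfolding I_def by (intro cInf_lower) auto
  have "\<exists>x. J x < I + 1 / Suc n" for n
    using cInf_lessD[of "range J" "I + 1 / Suc n"] unfolding I_def by auto
  then obtain X where X: "\<And>n. J (X n) < I + 1 / Suc n"
    by metis
  have JX: "(\<lambda>n. J (X n)) \<longlonglongrightarrow> I"
  proof (rule tendsto_sandwich)
    show "(\<lambda>_. I) \<longlonglongrightarrow> I" by simp
    show "(\<lambda>n. I + 1 / Suc n) \<longlonglongrightarrow> I"
      using tendsto_add[OF tendsto_const LIMSEQ_inverse_real_of_nat, of I]
      by (simp add: inverse_eq_divide)
  qed (use I X in \<open>auto intro!: always_eventually less_imp_le\<close>)
  have parallelogram: "(norm (x - y))\<^sup>2 \<le> 2 * (J x - I) + 2 * (J y - I)" for x y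
  proof -
    \<comment> \<open>The midpoint also satisfies \<open>I \<le> J w\<close>, which turns the
      parallelogram identity into an upper bound.\<close>
    define w where "w = (1/2) *\<^sub>R (x + y)"
    have "J w = (norm (x + y))\<^sup>2 / 4 - (Re (f x) + Re (f y))"
      by (simp add: w_def J_def power_divide add scaleR) (simp add: field_simps)
    then have "(norm (x - y))\<^sup>2 = 2 * J x + 2 * J y - 4 * J w"
      unfolding norm_add_power2 norm_diff_power2 J_def[of x] J_def[of y] by (simp add: field_simps)
    with I[of w] show ?thesis
      by argo
  qed
  have "Cauchy X"
  proof (rule metric_CauchyI)
    fix e :: real assume "0 < e"
    then have "0 < e\<^sup>2 / 4" by simp
    then have "eventually (\<lambda>n. J (X n) < I + e\<^sup>2 / 4) sequentially"
      using order_tendstoD(2)[OF JX] by simp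
    then obtain k where k: "\<And>n. n \<ge> k \<Longrightarrow> J (X n) < I + e\<^sup>2 / 4"
      by (auto simp: eventually_sequentially)
    have "dist (X m) (X n) < e" if "m \<ge> k" "n \<ge> k" for m n
    proof -
      have "(norm (X m - X n))\<^sup>2 < e\<^sup>2"
        using parallelogram[of "X m" "X n"] k[OF that(1)] k[OF that(2)] by argo
      then show ?thesis
        using \<open>0 < e\<close> by (simp add: dist_norm power2_less_imp_less)
    qed
    then show "\<exists>k. \<forall>m\<ge>k. \<forall>n\<ge>k. dist (X m) (X n) < e"
      by blast
  qed
  then obtain z where z: "X \<longlonglongrightarrow> z"
    using Cauchy_convergent convergent_def by blast
  have "(\<lambda>n. J (X n)) \<longlonglongrightarrow> J z"
    unfolding J_def by (intro tendsto_intros tendsto z)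
  then have Jz: "J z = I"
    using JX LIMSEQ_unique by blast
  \<comment> \<open>Moving from the minimiser \<open>z\<close> in the direction \<open>v\<close>
    cannot decrease \<open>J\<close>, so the linear coefficient in \<open>t\<close>
    vanishes.\<close>
  have Re_eq: "Re (f v) = Re (cinner v z)" for v
  proof -
    have "0 \<le> t\<^sup>2 * (norm v)\<^sup>2 + 2 * t * (Re (cinner v z) - Re (f v))" for t
    proof -
      have "J (z + t *\<^sub>R v) = J z + t\<^sup>2 * (norm v)\<^sup>2 + 2 * t * (Re (cinner v z) - Re (f v))"
        by (simp add: J_def norm_add_power2 add scaleR cinner_scaleR_right Re_cinner_commute[of z v]
            power_mult_distrib algebra_simps)
      with I[of "z + t *\<^sub>R v"] Jz show ?thesis by simp
    qed
    from linear_term_zero[OF this] show ?thesis by simp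
  qed
  \<comment> \<open>Both sides are complex linear in \<open>v\<close>, so replacing \<open>v\<close>
    by \<open>\<i> *\<^sub>C v\<close> turns real parts into negated imaginary parts.\<close>
  have "Im (f v) = Im (cinner v z)" for v
    using Re_eq[of "\<i> *\<^sub>C v"] by (simp add: fC cinner_scaleC_left)
  with Re_eq show ?thesis
    by (metis complex_eqI)
qed

section \<open>Operators and adjoints\<close>

lemmas app_simps = zero_cblinfun.rep_eq plus_cblinfun.rep_eq minus_cblinfun.rep_eq
  scale_op.rep_eq comp_op.rep_eq

lemma cblinfun_eqI: "(\<And>x. app S x = app T x) \<Longrightarrow> S = T"
  by (metis app_inject ext)

lemma bounded_linear_app: "bounded_linear (app T)"
  using app[of T] by blast

lemma app_scaleC: "app T (c *\<^sub>C x) = c *\<^sub>C app T x"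
  using app[of T] by blast

text \<open>Riesz representation, applied for each fixed \<open>y\<close>, gives the values of the
  adjoint; its linearity follows since inner products separate vectors.\<close>

lemma ex_adjoint:
  "\<exists>S. \<forall>x y. cinner (app T x) y = cinner x (app S y)"
proof -
  have "\<exists>z. \<forall>x. cinner (app T x) y = cinner x z" for y
    by (rule riesz_representation)
      (auto simp: app_scaleC cinner_scaleC_left
        intro: bounded_linear_compose[OF bounded_linear_cinner_left bounded_linear_app])
  then obtain g where g: "\<And>x y. cinner (app T x) y = cinner x (g y)"
    by metis
  obtain K where K: "\<And>x. norm (app T x) \<le> norm x * K" "0 < K"
    using bounded_linear.pos_bounded[OF bounded_linear_app[of T]] by metis
  have gC: "g (c *\<^sub>C y) = c *\<^sub>C g y" for c y
    by (rule cinner_eqI_right) (simp add: g[symmetric] cinner_scaleC_right)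
  have "bounded_linear g"
  proof (rule bounded_linear_intro)
    show "g (x + y) = g x + g y" for x y
      by (rule cinner_eqI_right) (simp add: g[symmetric] cinner_add_right)
    show "g (r *\<^sub>R x) = r *\<^sub>R g x" for r x
      by (metis gC scaleC_of_real)
    show "norm (g y) \<le> norm y * K" for y
    proof (cases "g y = 0")
      case False
      \<comment> \<open>Taking \<open>x = g y\<close> in the defining identity and dividing by
        \<open>norm (g y)\<close> gives the bound \<open>K\<close> of \<open>T\<close>.\<close>
      have "norm (g y) * norm (g y) = cmod (cinner (app T (g y)) y)"
        by (simp only: g cinner_self norm_of_real) (simp add: power2_eq_square)
      also have "\<dots> \<le> norm (app T (g y)) * norm y"
        by (rule norm_cinner_le)
      also have "\<dots> \<le> (norm (g y) * K) * norm y"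
        by (intro mult_right_mono K) simp
      finally have "norm (g y) * norm (g y) \<le> norm (g y) * (norm y * K)"
        by (simp add: ac_simps)
      with False show ?thesis by simp
    qed (use K in auto)
  qed
  then have "app (Cblinfun g) = g"
    using gC by (intro Cblinfun_inverse) auto
  with g show ?thesis by metis
qed

text \<open>Uniqueness of the adjoint. It resolves the \<open>THE\<close> once, so that later
  identities for \<open>adj\<close> are checked on inner products.\<close>

lemma adj_eqI:
  assumes "\<And>x y. cinner (app T x) y = cinner x (app S y)"
  shows "adj T = S"
  unfolding adj_def
proof (rule the_equality)
  show "\<forall>x y. cinner (app T x) y = cinner x (app S y)"
    using assms by simp
  show "U = S" if "\<forall>x y. cinner (app T x) y = cinner x (app U y)" for U
  proof (rule cblinfun_eqI, rule cinner_eqI_right)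
    show "cinner z (app U y) = cinner z (app S y)" for y z
      using that assms[of z y] by metis
  qed
qed

lemma cinner_adj_right: "cinner x (app (adj T) y) = cinner (app T x) y"
  using ex_adjoint[of T] adj_eqI by metis

lemma cinner_adj_left: "cinner (app (adj T) x) y = cinner x (app T y)"
  by (metis cinner_adj_right cinner_commute)

lemma adj_adj [simp]: "adj (adj T) = T"
  by (rule adj_eqI) (simp add: cinner_adj_left)

lemma adj_comp [simp]: "adj (S \<circ>\<^sub>C T) = adj T \<circ>\<^sub>C adj S"
  by (rule adj_eqI) (simp add: cinner_adj_right app_simps)

lemma adj_zero [simp]: "adj 0 = 0"
  by (rule adj_eqI) (metis app_simps(1) cinner_diff_left cinner_diff_right diff_self)

lemma adj_add [simp]: "adj (S + T) = adj S + adj T"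
  by (rule adj_eqI) (simp add: cinner_adj_right app_simps cinner_add_left cinner_add_right)

lemma adj_scale [simp]: "adj (scale_op c T) = scale_op (cnj c) (adj T)"
  by (rule adj_eqI) (simp add: cinner_adj_right app_simps cinner_scaleC_left cinner_scaleC_right)

lemma adj_image_adj [simp]: "adj ` adj ` X = X"
  by (simp add: image_image)

lemma comp_assoc: "(S \<circ>\<^sub>C T) \<circ>\<^sub>C U = S \<circ>\<^sub>C (T \<circ>\<^sub>C U)"
  by (rule cblinfun_eqI) (simp add: app_simps)

lemma comp_zero [simp]: "S \<circ>\<^sub>C 0 = 0" "0 \<circ>\<^sub>C S = 0"
  by (auto intro!: cblinfun_eqI simp: app_simps linear_simps(3)[OF bounded_linear_app])

lemma comp_add: "S \<circ>\<^sub>C (T + U) = S \<circ>\<^sub>C T + S \<circ>\<^sub>C U" "(V + W) \<circ>\<^sub>C X = V \<circ>\<^sub>C X + W \<circ>\<^sub>C X"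
  by (auto intro!: cblinfun_eqI simp: app_simps linear_simps(1)[OF bounded_linear_app])

lemma comp_scale [simp]: "S \<circ>\<^sub>C scale_op c T = scale_op c (S \<circ>\<^sub>C T)"
    "scale_op c V \<circ>\<^sub>C W = scale_op c (V \<circ>\<^sub>C W)"
  by (auto intro!: cblinfun_eqI simp: app_simps app_scaleC)

lift_definition id_op :: "('a::complex_hilbert, 'a) cblinfun" is "\<lambda>x. x"
  by simp

lemma comp_id [simp]: "S \<circ>\<^sub>C id_op = S" "id_op \<circ>\<^sub>C S = S"
  by (auto intro!: cblinfun_eqI simp: app_simps id_op.rep_eq)

lemma adj_id [simp]: "adj id_op = id_op"
  by (rule adj_eqI) (simp add: id_op.rep_eq)

section \<open>The weak-* topology\<close>

text \<open>The space of a generated topology is the union of its generators; zero sequences with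
  \<open>U = UNIV\<close> already yield everything.\<close>

lemma topspace_weak_star [simp]: "topspace weak_star = UNIV"
proof -
  have "UNIV \<in> {normal_functional x y -` U | (x :: nat \<Rightarrow> 'a) (y :: nat \<Rightarrow> 'b) U.
      square_summable x \<and> square_summable y \<and> open U}"
    by (rule CollectI, rule exI[of _ "\<lambda>_. 0"], rule exI[of _ "\<lambda>_. 0"], rule exI[of _ UNIV])
      (simp add: square_summable_def)
  then show ?thesis
    by (auto simp: weak_star_def topology_generated_by_topspace)
qed

text \<open>A map that pulls normal functionals back to translates of normal functionals pulls subbasic
  open sets back to subbasic open sets.\<close>

lemma continuous_map_weak_starI:
  fixes f :: "('a::complex_hilbert, 'b::complex_hilbert) cblinfun
    \<Rightarrow> ('c::complex_hilbert, 'd::complex_hilbert) cblinfun"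
  assumes "\<And>x y. square_summable x \<Longrightarrow> square_summable y \<Longrightarrow>
    \<exists>x' y' d. square_summable x' \<and> square_summable y' \<and>
      (\<forall>T. normal_functional x y (f T) = normal_functional x' y' T + d)"
  shows "continuous_map weak_star weak_star f"
  unfolding weak_star_def[where ?'a = 'c and ?'b = 'd]
proof (rule continuous_on_generated_topo, goal_cases)
  case (1 V)
  then obtain x y U where V: "V = normal_functional x y -` U"
    and xy: "square_summable x" "square_summable y" and U: "open U"
    by blast
  from assms[OF xy] obtain x' y' d where xy': "square_summable x'" "square_summable y'"
    and eq: "\<And>T. normal_functional x y (f T) = normal_functional x' y' T + d"
    by blast
  have "f -` V = normal_functional x' y' -` ((\<lambda>w. w + d) -` U)"
    by (auto simp: V eq)
  moreover have "open ((\<lambda>w. w + d) -` U)"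
    by (intro open_vimage U continuous_intros)
  ultimately have "openin weak_star (f -` V)"
    unfolding weak_star_def by (intro topology_generated_by_Basis) (use xy' in blast)
  then show ?case
    by simp
next
  case 2
  then show ?case
    using topspace_weak_star[where ?'a = 'c and ?'b = 'd]
    by (simp add: weak_star_def topology_generated_by_topspace)
qed

lemma square_summable_bounded_linear:
  assumes "bounded_linear g" and x: "square_summable x"
  shows "square_summable (\<lambda>n. g (x n))"
proof -
  obtain K where K: "\<And>u. norm (g u) \<le> norm u * K"
    using bounded_linear.bounded[OF assms(1)] by blast
  have "summable (\<lambda>n. K\<^sup>2 * (norm (x n))\<^sup>2)"
    using x unfolding square_summable_def by (rule summable_mult)
  moreover have "norm ((norm (g (x n)))\<^sup>2) \<le> K\<^sup>2 * (norm (x n))\<^sup>2" for n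
    using power_mono[OF K[of "x n"], of 2] by (simp add: power_mult_distrib mult.commute)
  ultimately show ?thesis
    unfolding square_summable_def by (rule summable_comparison_test'[where N = 0])
qed

text \<open>Cauchy-Schwarz and \<open>2 * a * b \<le> a\<^sup>2 + b\<^sup>2\<close> dominate the
  terms by a summable series.\<close>

lemma summable_cinner:
  assumes "square_summable x" and "square_summable (y :: nat \<Rightarrow> 'a::complex_hilbert)"
  shows "summable (\<lambda>n. cinner (x n) (y n))"
proof (rule summable_comparison_test')
  show "summable (\<lambda>n. (norm (x n))\<^sup>2 + (norm (y n))\<^sup>2)"
    using assms unfolding square_summable_def by (rule summable_add)
  show "cmod (cinner (x n) (y n)) \<le> (norm (x n))\<^sup>2 + (norm (y n))\<^sup>2" for n
    using norm_cinner_le[of "x n" "y n"] sum_squares_bound[of "norm (x n)" "norm (y n)"]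
      mult_nonneg_nonneg[OF norm_ge_zero[of "x n"] norm_ge_zero[of "y n"]]
    by argo
qed

text \<open>A left factor moves onto the second sequence through its adjoint.\<close>

lemma continuous_map_comp_left: "continuous_map weak_star weak_star (\<lambda>T. R \<circ>\<^sub>C T)"
proof (rule continuous_map_weak_starI, goal_cases)
  case (1 x y)
  then show ?case
    by (intro exI[of _ x] exI[of _ "\<lambda>n. app (adj R) (y n)"] exI[of _ 0])
      (simp add: square_summable_bounded_linear[OF bounded_linear_app] normal_functional_def
        cinner_adj_right app_simps)
qed

lemma continuous_map_comp_right: "continuous_map weak_star weak_star (\<lambda>T. T \<circ>\<^sub>C R)"
proof (rule continuous_map_weak_starI, goal_cases)
  case (1 x y)
  then show ?case
    by (intro exI[of _ "\<lambda>n. app R (x n)"] exI[of _ y] exI[of _ 0])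
      (simp add: square_summable_bounded_linear[OF bounded_linear_app] normal_functional_def
        app_simps)
qed

lemma continuous_map_scale: "continuous_map weak_star weak_star (scale_op c)"
proof (rule continuous_map_weak_starI, goal_cases)
  case (1 x y)
  then show ?case
    by (intro exI[of _ "\<lambda>n. c *\<^sub>C x n"] exI[of _ y] exI[of _ 0])
      (simp add: square_summable_bounded_linear[OF bounded_linear_scaleC] normal_functional_def
        app_simps app_scaleC)
qed

text \<open>The translation constant is the value of the functional at \<open>S\<close>; splitting
  the series requires both parts to be summable.\<close>

lemma continuous_map_add: "continuous_map weak_star weak_star (\<lambda>T. S + T)"
proof (rule continuous_map_weak_starI, goal_cases)
  case (1 x y)
  have "normal_functional x y (S + T) = normal_functional x y T + normal_functional x y S" for T
    unfolding normal_functional_def app_simps cinner_add_left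
    by (subst suminf_add)
      (auto intro!: summable_cinner square_summable_bounded_linear[OF bounded_linear_app] 1
        simp: add.commute)
  with 1 show ?case
    by blast
qed

lemma closure_of_invariant:
  assumes "continuous_map weak_star weak_star f" and "\<And>T. T \<in> X \<Longrightarrow> f T \<in> weak_star closure_of Y"
    and "T \<in> weak_star closure_of X"
  shows "f T \<in> weak_star closure_of Y"
proof -
  have "f ` (weak_star closure_of X) \<subseteq> weak_star closure_of (f ` X)"
    using assms(1) by (simp add: continuous_map_image_closure_subset)
  also have "\<dots> \<subseteq> weak_star closure_of Y"
    using assms(2) by (intro closure_of_minimal) auto
  finally show ?thesis
    using assms(3) by blast
qed

text \<open>Addition is available only as a map continuous in one summand, so sums are treated in
  two rounds: first one summand stays in \<open>X\<close>, then both range over the closure.\<close>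

lemma subspace_closure_of:
  assumes "cop.subspace X"
  shows "cop.subspace (weak_star closure_of X)"
proof -
  have sub: "X \<subseteq> weak_star closure_of X"
    by (simp add: closure_of_subset)
  show ?thesis
  proof (rule cop.subspaceI)
    show "0 \<in> weak_star closure_of X"
      using sub cop.subspace_0[OF assms] by blast
    show "scale_op c T \<in> weak_star closure_of X" if "T \<in> weak_star closure_of X" for c T
      using closure_of_invariant[OF continuous_map_scale _ that] sub cop.subspace_scale[OF assms]
      by blast
    have *: "S + T \<in> weak_star closure_of X" if "S \<in> X" "T \<in> weak_star closure_of X" for S T
      using closure_of_invariant[OF continuous_map_add _ that(2)] sub that(1)
        cop.subspace_add[OF assms] by blast
    show "S + T \<in> weak_star closure_of X"
      if "S \<in> weak_star closure_of X" "T \<in> weak_star closure_of X" for S T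
    proof (rule closure_of_invariant[OF continuous_map_add _ that(2)])
      show "S + U \<in> weak_star closure_of X" if "U \<in> X" for U
        using *[OF that \<open>S \<in> weak_star closure_of X\<close>] by (simp add: add.commute)
    qed
  qed
qed

section \<open>Weak-* closed linear spans\<close>

lemma subspace_wspan: "cop.subspace (wspan X)"
  by (simp add: wspan_def subspace_closure_of)

lemma closedin_wspan: "closedin weak_star (wspan X)"
  by (simp add: wspan_def)

lemma wspan_superset: "X \<subseteq> wspan X"
  unfolding wspan_def using cop.span_superset closure_of_subset[of "cop.span X" weak_star] by auto

lemma wspan_base: "T \<in> X \<Longrightarrow> T \<in> wspan X"
  using wspan_superset by blast

lemma wspan_minimal:
  assumes "X \<subseteq> Y" "cop.subspace Y" "closedin weak_star Y"
  shows "wspan X \<subseteq> Y"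
  unfolding wspan_def by (intro closure_of_minimal cop.span_minimal assms)

text \<open>Two-sided multiplication is linear and weak-* continuous, so the preimage of
  \<open>Y\<close> is a weak-* closed subspace. Memberships thus need checking on generators
  only.\<close>

lemma wspan_comp_mem:
  assumes T: "T \<in> wspan X"
    and X: "\<And>U. U \<in> X \<Longrightarrow> R \<circ>\<^sub>C U \<circ>\<^sub>C S \<in> Y"
    and Y: "cop.subspace Y" "closedin weak_star Y"
  shows "R \<circ>\<^sub>C T \<circ>\<^sub>C S \<in> Y"
proof -
  let ?Z = "{U. R \<circ>\<^sub>C U \<circ>\<^sub>C S \<in> Y}"
  have "continuous_map weak_star weak_star ((\<lambda>U. U \<circ>\<^sub>C S) \<circ> (\<lambda>U. R \<circ>\<^sub>C U))"
    by (rule continuous_map_compose[OF continuous_map_comp_left continuous_map_comp_right])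
  then have "closedin weak_star ?Z"
    using closedin_continuous_map_preimage[OF _ Y(2)] by (fastforce simp: o_def)
  moreover have "cop.subspace ?Z"
    using Y(1) by (auto simp: cop.subspace_def comp_add)
  ultimately have "wspan X \<subseteq> ?Z"
    using X by (intro wspan_minimal) auto
  with T show ?thesis by blast
qed

section \<open>TRO equivalence\<close>

lemma op_prodI [intro]: "S \<in> X \<Longrightarrow> T \<in> Y \<Longrightarrow> S \<circ>\<^sub>C T \<in> X \<cdot>\<^sub>C Y"
  by (auto simp: op_prod_def)

lemma op_prodE [elim]:
  assumes "U \<in> X \<cdot>\<^sub>C Y"
  obtains S T where "U = S \<circ>\<^sub>C T" "S \<in> X" "T \<in> Y"
  using assms by (auto simp: op_prod_def)

lemma wspan_eq_self:
  assumes "wstar_closed_algebra \<A>"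
  shows "wspan \<A> = \<A>"
  using assms wspan_superset[of \<A>] wspan_minimal[of \<A> \<A>]
  by (auto simp: wstar_closed_algebra_def)

section \<open>Ternary rings of operators, reflexivity and symmetry\<close>

lemma tro_triple: "tro \<M> \<Longrightarrow> R \<in> \<M> \<Longrightarrow> S \<in> \<M> \<Longrightarrow> T \<in> \<M> \<Longrightarrow> R \<circ>\<^sub>C adj S \<circ>\<^sub>C T \<in> \<M>"
  unfolding tro_def by blast

text \<open>The triple product is linear in the outer factors and conjugate linear in the middle
  one; the inductions extend \<open>T\<close>, then \<open>S\<close>, then \<open>R\<close> to the
  span.\<close>

lemma tro_span:
  assumes X: "\<And>R S T. R \<in> X \<Longrightarrow> S \<in> X \<Longrightarrow> T \<in> X \<Longrightarrow> R \<circ>\<^sub>C adj S \<circ>\<^sub>C T \<in> cop.span X"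
  shows "tro (cop.span X)"
proof -
  let ?K = "cop.span X"
  have 1: "R \<circ>\<^sub>C adj S \<circ>\<^sub>C T \<in> ?K" if "T \<in> ?K" "R \<in> X" "S \<in> X" for R S T
    using that(1) that(2,3)
    by (induction rule: cop.span_induct_alt)
      (simp_all add: comp_add cop.span_zero cop.span_add cop.span_scale X)
  have 2: "R \<circ>\<^sub>C adj S \<circ>\<^sub>C T \<in> ?K" if "S \<in> ?K" "R \<in> X" "T \<in> ?K" for R S T
    using that(1) that(2,3)
    by (induction rule: cop.span_induct_alt)
      (simp_all add: comp_add cop.span_zero cop.span_add cop.span_scale 1)
  have 3: "R \<circ>\<^sub>C adj S \<circ>\<^sub>C T \<in> ?K" if "R \<in> ?K" "S \<in> ?K" "T \<in> ?K" for R S T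
    using that(1) that(2,3)
    by (induction rule: cop.span_induct_alt)
      (simp_all add: comp_add cop.span_zero cop.span_add cop.span_scale 2)
  then show ?thesis
    unfolding tro_def by (auto elim!: op_prodE)
qed

text \<open>Taking adjoints reverses a triple product, so the TRO inclusion for \<open>\<M>\<close>
  applies with the factors in opposite order.\<close>

lemma tro_adj:
  assumes "tro \<M>"
  shows "tro (adj ` \<M>)"
proof -
  have M: "cop.subspace \<M>"
    using assms by (simp add: tro_def)
  have "cop.subspace (adj ` \<M>)"
  proof (rule cop.subspaceI)
    show "0 \<in> adj ` \<M>"
      using cop.subspace_0[OF M] by (metis adj_zero imageI)
    show "S + T \<in> adj ` \<M>" if "S \<in> adj ` \<M>" "T \<in> adj ` \<M>" for S T
      using that cop.subspace_add[OF M] by (auto simp flip: adj_add)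
    show "scale_op c T \<in> adj ` \<M>" if "T \<in> adj ` \<M>" for c T
    proof -
      obtain S where "S \<in> \<M>" "T = adj S" using \<open>T \<in> adj ` \<M>\<close> by blast
      then have "scale_op c T = adj (scale_op (cnj c) S)" "scale_op (cnj c) S \<in> \<M>"
        using cop.subspace_scale[OF M] by auto
      then show ?thesis by blast
    qed
  qed
  moreover have "adj ` \<M> \<cdot>\<^sub>C adj ` adj ` \<M> \<cdot>\<^sub>C adj ` \<M> \<subseteq> adj ` \<M>"
  proof
    fix U assume "U \<in> adj ` \<M> \<cdot>\<^sub>C adj ` adj ` \<M> \<cdot>\<^sub>C adj ` \<M>"
    then obtain R S T where "R \<in> \<M>" "S \<in> \<M>" "T \<in> \<M>" "U = adj R \<circ>\<^sub>C S \<circ>\<^sub>C adj T"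
      by (auto elim!: op_prodE)
    then have "U = adj (T \<circ>\<^sub>C adj S \<circ>\<^sub>C R)" "T \<circ>\<^sub>C adj S \<circ>\<^sub>C R \<in> \<M>"
      using tro_triple[OF assms] by (auto simp: comp_assoc)
    then show "U \<in> adj ` \<M>" by blast
  qed
  ultimately show ?thesis
    by (simp add: tro_def)
qed

lemma tro_equivalent_refl:
  assumes "wstar_closed_algebra \<A>"
  shows "tro_equivalent \<A> \<A>"
proof -
  let ?M = "range (\<lambda>c. scale_op c id_op)"
  have A: "cop.subspace \<A>"
    using assms by (simp add: wstar_closed_algebra_def)
  have adjM: "adj ` ?M = ?M"
    by (auto simp: image_image) (metis complex_cnj_cnj rangeI)
  have "cop.subspace ?M"
    using cop.subspace_span[of "{id_op}"] by (simp add: cop.span_singleton)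
  moreover have "?M \<cdot>\<^sub>C ?M \<cdot>\<^sub>C ?M \<subseteq> ?M"
    by (auto elim!: op_prodE)
  ultimately have "tro ?M"
    by (simp add: tro_def adjM)
  moreover have "?M \<cdot>\<^sub>C \<A> \<cdot>\<^sub>C ?M = \<A>"
  proof
    show "?M \<cdot>\<^sub>C \<A> \<cdot>\<^sub>C ?M \<subseteq> \<A>"
      by (auto elim!: op_prodE intro!: cop.subspace_scale[OF A])
    show "\<A> \<subseteq> ?M \<cdot>\<^sub>C \<A> \<cdot>\<^sub>C ?M"
    proof
      fix T assume "T \<in> \<A>"
      \<comment> \<open>The unit is taken from the TRO, since \<open>\<A>\<close> itself may be
        nonunital.\<close>
      moreover have "id_op \<in> ?M"
        by (rule image_eqI[of _ _ 1]) auto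
      ultimately have "id_op \<circ>\<^sub>C T \<circ>\<^sub>C id_op \<in> ?M \<cdot>\<^sub>C \<A> \<cdot>\<^sub>C ?M"
        by blast
      then show "T \<in> ?M \<cdot>\<^sub>C \<A> \<cdot>\<^sub>C ?M" by simp
    qed
  qed
  ultimately show ?thesis
    unfolding tro_equivalent_def using wspan_eq_self[OF assms]
    by (intro exI[of _ ?M]) (simp add: adjM)
qed

lemma tro_equivalent_sym: "tro_equivalent \<A> \<B> \<Longrightarrow> tro_equivalent \<B> \<A>"
  unfolding tro_equivalent_def using tro_adj adj_image_adj by metis

section \<open>Multipliers of a weak-* closed algebra\<close>

lemma tro_comp_mem:
  assumes M: "tro \<M>" and \<A>: "\<A> = wspan (\<M> \<cdot>\<^sub>C \<B> \<cdot>\<^sub>C adj ` \<M>)"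
    and R: "R \<in> \<M>" "S \<in> \<M>" and T: "T \<in> \<A>"
  shows "R \<circ>\<^sub>C adj S \<circ>\<^sub>C T \<in> \<A>" and "T \<circ>\<^sub>C (R \<circ>\<^sub>C adj S) \<in> \<A>"
proof -
  have "R \<circ>\<^sub>C adj S \<circ>\<^sub>C T \<circ>\<^sub>C id_op \<in> \<A>"
  proof (rule wspan_comp_mem[OF T[unfolded \<A>]])
    fix U assume "U \<in> \<M> \<cdot>\<^sub>C \<B> \<cdot>\<^sub>C adj ` \<M>"
    then obtain m b n where U: "U = m \<circ>\<^sub>C b \<circ>\<^sub>C adj n" "m \<in> \<M>" "b \<in> \<B>" "n \<in> \<M>"
      by (auto elim!: op_prodE)
    \<comment> \<open>On a generator, the TRO identity absorbs the left multiplier into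
      \<open>m\<close>.\<close>
    then have "(R \<circ>\<^sub>C adj S \<circ>\<^sub>C m) \<circ>\<^sub>C b \<circ>\<^sub>C adj n \<in> \<M> \<cdot>\<^sub>C \<B> \<cdot>\<^sub>C adj ` \<M>"
      using tro_triple[OF M] R by blast
    then show "R \<circ>\<^sub>C adj S \<circ>\<^sub>C U \<circ>\<^sub>C id_op \<in> \<A>"
      unfolding \<A> U by (auto simp: comp_assoc intro: wspan_base)
  qed (simp_all add: \<A> subspace_wspan closedin_wspan)
  then show "R \<circ>\<^sub>C adj S \<circ>\<^sub>C T \<in> \<A>" by simp
  have "id_op \<circ>\<^sub>C T \<circ>\<^sub>C (R \<circ>\<^sub>C adj S) \<in> \<A>"
  proof (rule wspan_comp_mem[OF T[unfolded \<A>]])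
    fix U assume "U \<in> \<M> \<cdot>\<^sub>C \<B> \<cdot>\<^sub>C adj ` \<M>"
    then obtain m b n where U: "U = m \<circ>\<^sub>C b \<circ>\<^sub>C adj n" "m \<in> \<M>" "b \<in> \<B>" "n \<in> \<M>"
      by (auto elim!: op_prodE)
    \<comment> \<open>On the right, \<open>adj n \<circ>\<^sub>C R \<circ>\<^sub>C adj S\<close> is
      the adjoint of a triple product in \<open>\<M>\<close>.\<close>
    then have "m \<circ>\<^sub>C b \<circ>\<^sub>C adj (S \<circ>\<^sub>C adj R \<circ>\<^sub>C n) \<in> \<M> \<cdot>\<^sub>C \<B> \<cdot>\<^sub>C adj ` \<M>"
      using tro_triple[OF M] R by blast
    then show "id_op \<circ>\<^sub>C U \<circ>\<^sub>C (R \<circ>\<^sub>C adj S) \<in> \<A>"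
      unfolding \<A> U by (auto simp: comp_assoc intro: wspan_base)
  qed (simp_all add: \<A> subspace_wspan closedin_wspan)
  then show "T \<circ>\<^sub>C (R \<circ>\<^sub>C adj S) \<in> \<A>" by simp
qed

text \<open>The expression is linear in \<open>R\<close> and conjugate linear in \<open>S\<close>;
  one induction extends each of them to the span.\<close>

lemma conjugation_span_mem:
  assumes X: "\<And>R S. R \<in> X \<Longrightarrow> S \<in> X \<Longrightarrow> R \<circ>\<^sub>C T \<circ>\<^sub>C adj S \<in> Y" and Y: "cop.subspace Y"
    and R: "R \<in> cop.span X" and S: "S \<in> cop.span X"
  shows "R \<circ>\<^sub>C T \<circ>\<^sub>C adj S \<in> Y"
proof -
  have *: "R \<circ>\<^sub>C T \<circ>\<^sub>C adj S \<in> Y" if "R \<in> cop.span X" "S \<in> X" for R S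
    using that
    by (induction rule: cop.span_induct_alt)
      (simp_all add: comp_add cop.subspace_0[OF Y] cop.subspace_add[OF Y] cop.subspace_scale[OF Y] X)
  from S R show ?thesis
    by (induction rule: cop.span_induct_alt)
      (simp_all add: comp_add cop.subspace_0[OF Y] cop.subspace_add[OF Y] cop.subspace_scale[OF Y] *)
qed

definition selfadjoint_multipliers ::
  "('a::complex_hilbert, 'a) cblinfun set \<Rightarrow> ('a, 'a) cblinfun set" where
  "selfadjoint_multipliers \<B> =
     {D. \<forall>T\<in>\<B>. D \<circ>\<^sub>C T \<in> \<B> \<and> T \<circ>\<^sub>C D \<in> \<B> \<and> adj D \<circ>\<^sub>C T \<in> \<B> \<and> T \<circ>\<^sub>C adj D \<in> \<B>}"

lemma selfadjoint_multipliers_id: "id_op \<in> selfadjoint_multipliers \<B>"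
  by (simp add: selfadjoint_multipliers_def)

lemma selfadjoint_multipliers_adj:
  "D \<in> selfadjoint_multipliers \<B> \<Longrightarrow> adj D \<in> selfadjoint_multipliers \<B>"
  by (simp add: selfadjoint_multipliers_def)

lemma selfadjoint_multipliers_comp:
  assumes "D \<in> selfadjoint_multipliers \<B>" "E \<in> selfadjoint_multipliers \<B>"
  shows "D \<circ>\<^sub>C E \<in> selfadjoint_multipliers \<B>"
  using assms by (auto simp: selfadjoint_multipliers_def comp_assoc) (metis comp_assoc)+

lemma selfadjoint_multipliers_mult:
  assumes "D \<in> selfadjoint_multipliers \<B>" "E \<in> selfadjoint_multipliers \<B>" "T \<in> \<B>"
  shows "D \<circ>\<^sub>C T \<circ>\<^sub>C E \<in> \<B>"
  using assms by (auto simp: selfadjoint_multipliers_def)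

text \<open>The adjoint of \<open>R \<circ>\<^sub>C adj S\<close> is
  \<open>S \<circ>\<^sub>C adj R\<close>, of the same form, so the absorption lemma yields all four
  conditions.\<close>

lemma tro_selfadjoint_multipliers:
  assumes "tro \<M>" "\<B> = wspan (\<M> \<cdot>\<^sub>C \<A> \<cdot>\<^sub>C adj ` \<M>)" "R \<in> \<M>" "S \<in> \<M>"
  shows "R \<circ>\<^sub>C adj S \<in> selfadjoint_multipliers \<B>"
  using tro_comp_mem[OF assms(1,2)] assms(3,4) by (simp add: selfadjoint_multipliers_def)

section \<open>The linking TRO and transitivity\<close>

definition linking_products ::
  "('b::complex_hilbert, 'c::complex_hilbert) cblinfun set \<Rightarrow> ('b, 'b) cblinfun set
    \<Rightarrow> ('a::complex_hilbert, 'b) cblinfun set \<Rightarrow> ('a, 'c) cblinfun set" where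
  "linking_products \<N> \<B> \<M> = \<N> \<cdot>\<^sub>C selfadjoint_multipliers \<B> \<cdot>\<^sub>C \<M>"

lemma linking_productsE:
  assumes "R \<in> linking_products \<N> \<B> \<M>"
  obtains n D m where "R = n \<circ>\<^sub>C D \<circ>\<^sub>C m" "n \<in> \<N>" "D \<in> selfadjoint_multipliers \<B>" "m \<in> \<M>"
  using assms by (auto simp: linking_products_def elim!: op_prodE)

text \<open>Selfadjointness of the multipliers gives one inclusion for all arguments; applying it to
  the adjoint TROs gives the other.\<close>

lemma adj_linking_products:
  "adj ` linking_products \<N> \<B> \<M> = linking_products (adj ` \<M>) \<B> (adj ` \<N>)"
proof -
  have *: "adj ` linking_products \<N> \<B> \<M> \<subseteq> linking_products (adj ` \<M>) \<B> (adj ` \<N>)" for \<N> \<B> \<M>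
    by (auto elim!: linking_productsE)
      (auto simp: linking_products_def comp_assoc[symmetric] intro!: op_prodI selfadjoint_multipliers_adj)
  have "adj ` linking_products (adj ` \<M>) \<B> (adj ` \<N>) \<subseteq> linking_products \<N> \<B> \<M>"
    using *[of "adj ` \<M>" \<B> "adj ` \<N>"] by simp
  then have "linking_products (adj ` \<M>) \<B> (adj ` \<N>) \<subseteq> adj ` linking_products \<N> \<B> \<M>"
    by (metis adj_image_adj image_mono)
  with * show ?thesis by blast
qed

lemma adj_span: "adj ` cop.span X = cop.span (adj ` X)"
proof -
  have *: "adj ` cop.span X \<subseteq> cop.span (adj ` X)" for X
  proof
    fix U assume "U \<in> adj ` cop.span X"
    then obtain T where "T \<in> cop.span X" "U = adj T" by blast
    from this(1) have "adj T \<in> cop.span (adj ` X)"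
      by (induction rule: cop.span_induct_alt)
        (simp_all add: cop.span_zero cop.span_add cop.span_scale cop.span_base)
    then show "U \<in> cop.span (adj ` X)" by (simp add: \<open>U = adj T\<close>)
  qed
  have "adj ` cop.span (adj ` X) \<subseteq> cop.span X"
    using *[of "adj ` X"] by simp
  then have "cop.span (adj ` X) \<subseteq> adj ` cop.span X"
    by (metis adj_image_adj image_mono)
  with * show ?thesis by blast
qed

text \<open>In a triple product of elements of \<open>\<N>\<D>\<M>\<close>, everything between the
  first factor from \<open>\<N>\<close> and the last from \<open>\<M>\<close> is a product of
  multipliers, hence again in \<open>\<D>\<close>.\<close>

lemma tro_linking:
  assumes M: "tro \<M>" "\<B> = wspan (\<M> \<cdot>\<^sub>C \<A> \<cdot>\<^sub>C adj ` \<M>)"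
    and N: "tro \<N>" "\<B> = wspan (adj ` \<N> \<cdot>\<^sub>C \<C> \<cdot>\<^sub>C \<N>)"
  shows "tro (cop.span (linking_products \<N> \<B> \<M>))"
proof (rule tro_span)
  fix R S T assume "R \<in> linking_products \<N> \<B> \<M>" "S \<in> linking_products \<N> \<B> \<M>"
    "T \<in> linking_products \<N> \<B> \<M>"
  then obtain n D m n' E m' n'' F m''
    where RST: "R = n \<circ>\<^sub>C D \<circ>\<^sub>C m" "S = n' \<circ>\<^sub>C E \<circ>\<^sub>C m'" "T = n'' \<circ>\<^sub>C F \<circ>\<^sub>C m''"
      and mem: "n \<in> \<N>" "n' \<in> \<N>" "n'' \<in> \<N>" "m \<in> \<M>" "m' \<in> \<M>" "m'' \<in> \<M>"
      and DEF: "D \<in> selfadjoint_multipliers \<B>" "E \<in> selfadjoint_multipliers \<B>"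
        "F \<in> selfadjoint_multipliers \<B>"
    by (metis linking_productsE)
  have mm: "m \<circ>\<^sub>C adj m' \<in> selfadjoint_multipliers \<B>"
    using tro_selfadjoint_multipliers[OF M] mem by blast
  \<comment> \<open>The adjoints of \<open>\<N>\<close> form a TRO that leads from
    \<open>\<C>\<close> to \<open>\<B>\<close>, so the multiplier lemma applies to them.\<close>
  have nn: "adj n' \<circ>\<^sub>C n'' \<in> selfadjoint_multipliers \<B>"
    using tro_selfadjoint_multipliers[OF tro_adj[OF N(1)], of \<B> \<C> "adj n'" "adj n''"] N(2) mem
    by simp
  have "D \<circ>\<^sub>C (m \<circ>\<^sub>C adj m') \<circ>\<^sub>C adj E \<circ>\<^sub>C (adj n' \<circ>\<^sub>C n'') \<circ>\<^sub>C F \<in> selfadjoint_multipliers \<B>"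
    by (intro selfadjoint_multipliers_comp selfadjoint_multipliers_adj DEF mm nn)
  then have "n \<circ>\<^sub>C (D \<circ>\<^sub>C (m \<circ>\<^sub>C adj m') \<circ>\<^sub>C adj E \<circ>\<^sub>C (adj n' \<circ>\<^sub>C n'') \<circ>\<^sub>C F) \<circ>\<^sub>C m''
      \<in> linking_products \<N> \<B> \<M>"
    using mem unfolding linking_products_def by blast
  then show "R \<circ>\<^sub>C adj S \<circ>\<^sub>C T \<in> cop.span (linking_products \<N> \<B> \<M>)"
    unfolding RST by (intro cop.span_base) (simp add: comp_assoc)
qed

text \<open>For one inclusion, an element of \<open>\<K>\<close> acts in three stages:
  \<open>\<M>\<close> carries \<open>\<A>\<close> into \<open>\<B>\<close>, multipliers preserve
  \<open>\<B>\<close>, and \<open>\<N>\<close> carries \<open>\<B>\<close> into \<open>\<C>\<close>.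
  For the other, the identity multiplier puts \<open>\<N>\<M>\<close> inside
  \<open>\<K>\<close>.\<close>

lemma wspan_linking:
  assumes B: "\<B> = wspan (\<M> \<cdot>\<^sub>C \<A> \<cdot>\<^sub>C adj ` \<M>)" and C: "\<C> = wspan (\<N> \<cdot>\<^sub>C \<B> \<cdot>\<^sub>C adj ` \<N>)"
  defines "\<K> \<equiv> cop.span (linking_products \<N> \<B> \<M>)"
  shows "\<C> = wspan (\<K> \<cdot>\<^sub>C \<A> \<cdot>\<^sub>C adj ` \<K>)"
proof
  have subC: "cop.subspace \<C>" and clC: "closedin weak_star \<C>"
    by (simp_all add: C subspace_wspan closedin_wspan)
  have "R \<circ>\<^sub>C a \<circ>\<^sub>C adj S \<in> \<C>" if "a \<in> \<A>" "R \<in> \<K>" "S \<in> \<K>" for R a S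
  proof (rule conjugation_span_mem[OF _ subC that(2,3)[unfolded \<K>_def]])
    fix R S assume "R \<in> linking_products \<N> \<B> \<M>" "S \<in> linking_products \<N> \<B> \<M>"
    then obtain n D m n' E m' where RS: "R = n \<circ>\<^sub>C D \<circ>\<^sub>C m" "S = n' \<circ>\<^sub>C E \<circ>\<^sub>C m'"
      and mem: "n \<in> \<N>" "n' \<in> \<N>" "m \<in> \<M>" "m' \<in> \<M>"
        "D \<in> selfadjoint_multipliers \<B>" "E \<in> selfadjoint_multipliers \<B>"
      by (metis linking_productsE)
    have "m \<circ>\<^sub>C a \<circ>\<^sub>C adj m' \<in> \<B>"
      unfolding B by (intro wspan_base op_prodI imageI mem \<open>a \<in> \<A>\<close>)
    then have "D \<circ>\<^sub>C (m \<circ>\<^sub>C a \<circ>\<^sub>C adj m') \<circ>\<^sub>C adj E \<in> \<B>"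
      by (intro selfadjoint_multipliers_mult selfadjoint_multipliers_adj mem)
    then have "n \<circ>\<^sub>C (D \<circ>\<^sub>C (m \<circ>\<^sub>C a \<circ>\<^sub>C adj m') \<circ>\<^sub>C adj E) \<circ>\<^sub>C adj n' \<in> \<C>"
      unfolding C by (intro wspan_base op_prodI imageI mem)
    then show "R \<circ>\<^sub>C a \<circ>\<^sub>C adj S \<in> \<C>"
      by (simp add: RS comp_assoc)
  qed
  then show "wspan (\<K> \<cdot>\<^sub>C \<A> \<cdot>\<^sub>C adj ` \<K>) \<subseteq> \<C>"
    by (intro wspan_minimal subC clC) (auto elim!: op_prodE)
  have NM: "n \<circ>\<^sub>C m \<in> \<K>" if "n \<in> \<N>" "m \<in> \<M>" for n m
  proof -
    have "n \<circ>\<^sub>C id_op \<circ>\<^sub>C m \<in> linking_products \<N> \<B> \<M>"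
      unfolding linking_products_def using that selfadjoint_multipliers_id by blast
    then show ?thesis
      by (simp add: \<K>_def cop.span_base)
  qed
  \<comment> \<open>Since \<open>b\<close> is only a weak-* limit of combinations of generators,
    continuity reduces the claim to a generator of \<open>\<B>\<close>.\<close>
  have "n \<circ>\<^sub>C b \<circ>\<^sub>C adj n' \<in> wspan (\<K> \<cdot>\<^sub>C \<A> \<cdot>\<^sub>C adj ` \<K>)"
    if "n \<in> \<N>" "n' \<in> \<N>" "b \<in> \<B>" for n n' b
  proof (rule wspan_comp_mem[OF that(3)[unfolded B] _ subspace_wspan closedin_wspan])
    fix U assume "U \<in> \<M> \<cdot>\<^sub>C \<A> \<cdot>\<^sub>C adj ` \<M>"
    then obtain m a m' where U: "U = m \<circ>\<^sub>C a \<circ>\<^sub>C adj m'" "m \<in> \<M>" "a \<in> \<A>" "m' \<in> \<M>"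
      by (auto elim!: op_prodE)
    then have "(n \<circ>\<^sub>C m) \<circ>\<^sub>C a \<circ>\<^sub>C adj (n' \<circ>\<^sub>C m') \<in> \<K> \<cdot>\<^sub>C \<A> \<cdot>\<^sub>C adj ` \<K>"
      using NM that by blast
    then show "n \<circ>\<^sub>C U \<circ>\<^sub>C adj n' \<in> wspan (\<K> \<cdot>\<^sub>C \<A> \<cdot>\<^sub>C adj ` \<K>)"
      by (auto simp: U comp_assoc intro: wspan_base)
  qed
  then show "\<C> \<subseteq> wspan (\<K> \<cdot>\<^sub>C \<A> \<cdot>\<^sub>C adj ` \<K>)"
    unfolding C by (intro wspan_minimal subspace_wspan closedin_wspan) (auto elim!: op_prodE)
qed

lemma tro_equivalent_trans:
  assumes "tro_equivalent \<A> \<B>" "tro_equivalent \<B> \<C>"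
  shows "tro_equivalent \<A> \<C>"
proof -
  obtain \<M> where M: "tro \<M>" "\<A> = wspan (adj ` \<M> \<cdot>\<^sub>C \<B> \<cdot>\<^sub>C \<M>)" "\<B> = wspan (\<M> \<cdot>\<^sub>C \<A> \<cdot>\<^sub>C adj ` \<M>)"
    using assms(1) unfolding tro_equivalent_def by blast
  obtain \<N> where N: "tro \<N>" "\<B> = wspan (adj ` \<N> \<cdot>\<^sub>C \<C> \<cdot>\<^sub>C \<N>)" "\<C> = wspan (\<N> \<cdot>\<^sub>C \<B> \<cdot>\<^sub>C adj ` \<N>)"
    using assms(2) unfolding tro_equivalent_def by blast
  let ?K = "cop.span (linking_products \<N> \<B> \<M>)"
  \<comment> \<open>The adjoint of the linking TRO is the linking TRO of the reversed chain from
    \<open>\<C>\<close> through \<open>\<B>\<close> to \<open>\<A>\<close>, so the same lemma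
    provides the second equation.\<close>
  have adjK: "cop.span (linking_products (adj ` \<M>) \<B> (adj ` \<N>)) = adj ` ?K"
    by (simp add: adj_span adj_linking_products)
  have "tro ?K"
    by (rule tro_linking[OF M(1,3) N(1,2)])
  moreover have "\<C> = wspan (?K \<cdot>\<^sub>C \<A> \<cdot>\<^sub>C adj ` ?K)"
    by (rule wspan_linking[OF M(3) N(3)])
  moreover have "\<A> = wspan (adj ` ?K \<cdot>\<^sub>C \<C> \<cdot>\<^sub>C ?K)"
  proof -
    have "\<B> = wspan (adj ` \<N> \<cdot>\<^sub>C \<C> \<cdot>\<^sub>C adj ` adj ` \<N>)"
      and "\<A> = wspan (adj ` \<M> \<cdot>\<^sub>C \<B> \<cdot>\<^sub>C adj ` adj ` \<M>)"
      using N(2) M(2) by simp_all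
    from wspan_linking[OF this] show ?thesis
      by (simp only: adjK adj_image_adj)
  qed
  ultimately show ?thesis
    unfolding tro_equivalent_def by blast
qed

theorem theorem2p3:
  shows "(\<forall>\<A> :: ('a::complex_hilbert, 'a) cblinfun set.
            wstar_closed_algebra \<A> \<longrightarrow> tro_equivalent \<A> \<A>) \<and>
         (\<forall>(\<A> :: ('a, 'a) cblinfun set) (\<B> :: ('b::complex_hilbert, 'b) cblinfun set).
            wstar_closed_algebra \<A> \<longrightarrow> wstar_closed_algebra \<B> \<longrightarrow>
            tro_equivalent \<A> \<B> \<longrightarrow> tro_equivalent \<B> \<A>) \<and>
         (\<forall>(\<A> :: ('a, 'a) cblinfun set) (\<B> :: ('b, 'b) cblinfun set)
            (\<C> :: ('c::complex_hilbert, 'c) cblinfun set).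
            wstar_closed_algebra \<A> \<longrightarrow> wstar_closed_algebra \<B> \<longrightarrow> wstar_closed_algebra \<C> \<longrightarrow>
            tro_equivalent \<A> \<B> \<longrightarrow> tro_equivalent \<B> \<C> \<longrightarrow> tro_equivalent \<A> \<C>)"
  using tro_equivalent_refl tro_equivalent_sym tro_equivalent_trans by blast

end
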